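(* If $(X,\tau)$ is a $T_1$ topological space, then for every topological model $\mathcal{M}$ on $(X,\tau)$ and every formula $\varphi$: $$\llbracket\Diamond_{\mathrm{ns}}\varphi\rrbracket=\llbracket\Diamond_d\varphi\rrbracket.$$
   Context: Nonstandard setting. For a topological space $(X,\tau)$ let $S=X\cup\mathbb{R}$ and let $V(S)=\bigcup_{k\in\mathbb{N}_0}V_k(S)$ be the superstructure over $S$, where $V_0(S)=S$ and $V_{k+1}(S)=V_k(S)\cup\mathcal{P}(V_k(S))$. A polysaturated nonstandard model is a superstructure $V({}^*S)$ with a star map $A\mapsto{}^*A$ from $V(S)$ to $V({}^*S)$ such that: (1) Extension: ${}^*s=s$ for all $s\in S$; (2) Transfer: a bounded quantifier formula $\Phi(A_1,\dots,A_n)$ is true in $V(S)$ iff $\Phi({}^*A_1,\dots,{}^*A_n)$ is true in $V({}^*S)$; (3) Saturation: every family of internal sets of cardinality at most $\kappa$ with the finite intersection property has non-empty intersection, where $\kappa\ge|V(S)|$ is a fixed cardinal. A set is internal if it is an element of ${}^*C$ for some $C\in V(S)$. One such model is fixed throughout. In particular $X\subseteq{}^*X$. Halo. For $x\in X$, $\mathcal{N}(x)=\{U\in\tau: x\in U\}$ and $\mu(x)=\bigcap_{U\in\mathcal{N}(x)}{}^*U$. Modal semantics. Formulas are built from propositional variables, $\bot$, $\neg$, $\wedge$ and the unary diamonds $\Diamond_d,\Diamond_{\mathrm{ns}}$, each interpreted by its own clause. A topological model is $\mathcal{M}=((X,\tau),\nu)$ with $\nu$ a map from propositional variables to $\mathcal{P}(X)$.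 The extension $\llbracket\varphi\rrbracket\subseteq X$ is defined with $\llbracket p\rrbracket=\nu(p)$, Boolean clauses as usual, $\llbracket\Diamond_d\varphi\rrbracket=\{x\in X:\mu(x)\cap({}^*\llbracket\varphi\rrbracket\setminus\{x\})\neq\emptyset\}$ and $\llbracket\Diamond_{\mathrm{ns}}\varphi\rrbracket=\{x\in X:\mu(x)\cap({}^*\llbracket\varphi\rrbracket\setminus X)\neq\emptyset\}$. *)

theory Defs
  imports "HOL-Analysis.Analysis"
begin

unbundle cardinal_syntax

section \<open>Superstructures\<close>

text \<open>
  The cumulative hierarchy over an infinite set is too large for any type that can be constructed
  in HOL.  We therefore work over an ambient universe of individuals and sets with a membership
  relation: an arbitrary type \<open>'u\<close> whose members are either individuals (without elements) or
  sets (determined by their elements).  That power sets in the hierarchy are full, i.e. that every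
  HOL set of objects of one level is the extension of an object, is part of
  \<open>full_superstructure\<close> below.
\<close>

record 'u universe =
  mem :: "'u \<Rightarrow> 'u \<Rightarrow> bool"
  individuals :: "'u set"

definition elems :: "'u universe \<Rightarrow> 'u \<Rightarrow> 'u set" where
  "elems U a = {b. mem U b a}"

locale set_universe =
  fixes U :: "'u universe"
  assumes individual_no_elems: "a \<in> individuals U \<Longrightarrow> elems U a = {}"
    and extensionality:
      "\<lbrakk>a \<notin> individuals U; b \<notin> individuals U; elems U a = elems U b\<rbrakk> \<Longrightarrow> a = b"

primrec level :: "'u universe \<Rightarrow> 'u set \<Rightarrow> nat \<Rightarrow> 'u set" where
  "level U S 0 = S"
| "level U S (Suc k) =
     level U S k \<union> {a. a \<notin> individuals U \<and> elems U a \<subseteq> level U S k}"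

definition superstructure :: "'u universe \<Rightarrow> 'u set \<Rightarrow> 'u set" where
  "superstructure U S = (\<Union>k. level U S k)"

definition full_superstructure :: "'u universe \<Rightarrow> 'u set \<Rightarrow> bool" where
  "full_superstructure U S \<longleftrightarrow>
     S \<subseteq> individuals U \<and>
     (\<forall>k. \<forall>A \<subseteq> level U S k. \<exists>a. a \<notin> individuals U \<and> elems U a = A)"

text \<open>Well defined on subsets of a level of a full superstructure, by extensionality.\<close>

definition code :: "'u universe \<Rightarrow> 'u set \<Rightarrow> 'u" where
  "code U A = (THE a. a \<notin> individuals U \<and> elems U a = A)"


section \<open>Bounded quantifier formulas\<close>

text \<open>
  \<open>BAll i j \<Phi>\<close> is \<open>\<forall>x\<^sub>i \<in> x\<^sub>j. \<Phi>\<close>; the other connectives and the bounded existential quantifier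
  are definable.  The objects \<open>A\<^sub>1, \<dots>, A\<^sub>n\<close> substituted for the free variables are given by an
  assignment.
\<close>

datatype bformula =
    BEq nat nat
  | BMem nat nat
  | BNot bformula
  | BAnd bformula bformula
  | BAll nat nat bformula

primrec sat :: "'u universe \<Rightarrow> 'u set \<Rightarrow> (nat \<Rightarrow> 'u) \<Rightarrow> bformula \<Rightarrow> bool" where
  "sat U M \<rho> (BEq i j) \<longleftrightarrow> \<rho> i = \<rho> j"
| "sat U M \<rho> (BMem i j) \<longleftrightarrow> mem U (\<rho> i) (\<rho> j)"
| "sat U M \<rho> (BNot \<Phi>) \<longleftrightarrow> \<not> sat U M \<rho> \<Phi>"
| "sat U M \<rho> (BAnd \<Phi> \<Psi>) \<longleftrightarrow> sat U M \<rho> \<Phi> \<and> sat U M \<rho> \<Psi>"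
| "sat U M \<rho> (BAll i j \<Phi>) \<longleftrightarrow>
     (\<forall>b\<in>M. mem U b (\<rho> j) \<longrightarrow> sat U M (\<rho>(i := b)) \<Phi>)"


section \<open>Polysaturated nonstandard models\<close>

text \<open>\<open>star_set\<close> is the star map on HOL sets: the extension of \<open>\<^sup>*A\<close>.\<close>

definition star_set :: "'u universe \<Rightarrow> ('u \<Rightarrow> 'u) \<Rightarrow> 'u set \<Rightarrow> 'u set" where
  "star_set U star A = elems U (star (code U A))"

definition internal :: "'u universe \<Rightarrow> ('u \<Rightarrow> 'u) \<Rightarrow> 'u set \<Rightarrow> 'u \<Rightarrow> bool" where
  "internal U star S a \<longleftrightarrow> (\<exists>C \<in> superstructure U S. a \<in> elems U (star C))"

definition fin_inter_property :: "'u set set \<Rightarrow> bool" where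
  "fin_inter_property \<F> \<longleftrightarrow> (\<forall>\<G> \<subseteq> \<F>. finite \<G> \<longrightarrow> \<G> \<noteq> {} \<longrightarrow> \<Inter>\<G> \<noteq> {})"

text \<open>
  The map \<open>r\<close> names the real numbers as individuals; the copy of the reals and the topological
  space may overlap.
\<close>

definition base_set :: "'u topology \<Rightarrow> (real \<Rightarrow> 'u) \<Rightarrow> 'u set" where
  "base_set X r = topspace X \<union> range r"

locale polysaturated_model = set_universe U
  for U :: "'u universe" +
  fixes X :: "'u topology"
    and r :: "real \<Rightarrow> 'u"
    and star :: "'u \<Rightarrow> 'u"
    and \<kappa> :: "'k rel"
  assumes inj_reals: "inj r"
    and full_standard: "full_superstructure U (base_set X r)"
    and full_nonstandard: "full_superstructure U (star_set U star (base_set X r))"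
    and star_closed:
      "a \<in> superstructure U (base_set X r) \<Longrightarrow>
         star a \<in> superstructure U (star_set U star (base_set X r))"
    and extension: "s \<in> base_set X r \<Longrightarrow> star s = s"
    and transfer:
      "range \<rho> \<subseteq> superstructure U (base_set X r) \<Longrightarrow>
         sat U (superstructure U (base_set X r)) \<rho> \<Phi> \<longleftrightarrow>
         sat U (superstructure U (star_set U star (base_set X r))) (star \<circ> \<rho>) \<Phi>"
    and cardinal: "Card_order \<kappa>" "|superstructure U (base_set X r)| \<le>o \<kappa>"
    and saturation:
      "\<lbrakk>\<And>a. a \<in> F \<Longrightarrow> a \<notin> individuals U \<and> internal U star (base_set X r) a;
        |F| \<le>o \<kappa>; fin_inter_property (elems U ` F)\<rbrakk>
       \<Longrightarrow> \<Inter>(elems U ` F) \<noteq> {}"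

definition halo :: "'u universe \<Rightarrow> ('u \<Rightarrow> 'u) \<Rightarrow> 'u topology \<Rightarrow> 'u \<Rightarrow> 'u set" where
  "halo U star X x = (\<Inter>V \<in> {V. openin X V \<and> x \<in> V}. star_set U star V)"


section \<open>Modal semantics\<close>

datatype 'p mformula =
    Var 'p
  | Bot
  | Neg "'p mformula"
  | Conj "'p mformula" "'p mformula"
  | Dia_d "'p mformula"
  | Dia_ns "'p mformula"

definition topological_model :: "'u topology \<Rightarrow> ('p \<Rightarrow> 'u set) \<Rightarrow> bool" where
  "topological_model X \<nu> \<longleftrightarrow> (\<forall>p. \<nu> p \<subseteq> topspace X)"

primrec truth_set ::
  "'u universe \<Rightarrow> ('u \<Rightarrow> 'u) \<Rightarrow> 'u topology \<Rightarrow> ('p \<Rightarrow> 'u set) \<Rightarrow> 'p mformula \<Rightarrow> 'u set"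
where
  "truth_set U star X \<nu> (Var p) = \<nu> p"
| "truth_set U star X \<nu> Bot = {}"
| "truth_set U star X \<nu> (Neg \<phi>) = topspace X - truth_set U star X \<nu> \<phi>"
| "truth_set U star X \<nu> (Conj \<phi> \<psi>) = truth_set U star X \<nu> \<phi> \<inter> truth_set U star X \<nu> \<psi>"
| "truth_set U star X \<nu> (Dia_d \<phi>) =
     {x \<in> topspace X. halo U star X x \<inter> (star_set U star (truth_set U star X \<nu> \<phi>) - {x}) \<noteq> {}}"
| "truth_set U star X \<nu> (Dia_ns \<phi>) =
     {x \<in> topspace X.
        halo U star X x \<inter> (star_set U star (truth_set U star X \<nu> \<phi>) - topspace X) \<noteq> {}}"

end

theory Submission
  imports Defs
begin

text \<open>
  Both diamonds ask for a point of \<open>\<^sup>*A\<close> in the halo of \<open>x\<close>, where \<open>A\<close> is the truth set of the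
  formula below the diamond; \<open>\<Diamond>\<^sub>d\<close> excludes only the point \<open>x\<close>, while \<open>\<Diamond>\<^sub>n\<^sub>s\<close> excludes all
  standard points.  In a \<open>T\<^sub>1\<close> space these exclusions agree inside the halo, because the halo of \<open>x\<close>
  contains no standard point other than \<open>x\<close> (\<open>halo_Int_topspace_subset_if_t1\<close>): a point
  \<open>y \<noteq> x\<close> is missed by some open neighbourhood \<open>V\<close> of \<open>x\<close>, and then \<open>y\<close> is missed by \<open>\<^sup>*V\<close> as
  well, since the star map adds only nonstandard points to a set of individuals
  (\<open>mem_star_set_iff\<close>, an instance of transfer).
\<close>

context polysaturated_model
begin

lemma
  assumes "A \<subseteq> base_set X r"
  shows code_not_individual: "code U A \<notin> individuals U"
    and elems_code: "elems U (code U A) = A"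
proof -
  have "\<exists>a. a \<notin> individuals U \<and> elems U a = A"
    using full_standard assms unfolding full_superstructure_def by (metis level.simps(1))
  then have "\<exists>!a. a \<notin> individuals U \<and> elems U a = A"
    using extensionality by blast
  then have "code U A \<notin> individuals U \<and> elems U (code U A) = A"
    unfolding code_def by (rule theI')
  then show "code U A \<notin> individuals U" "elems U (code U A) = A"
    by auto
qed

lemma base_set_subset_superstructure: "base_set X r \<subseteq> superstructure U (base_set X r)"
  unfolding superstructure_def by (metis UN_upper UNIV_I level.simps(1))

lemma code_in_superstructure:
  assumes "A \<subseteq> base_set X r"
  shows "code U A \<in> superstructure U (base_set X r)"
proof -
  have "code U A \<in> level U (base_set X r) (Suc 0)"
    using assms code_not_individual elems_code by simp
  then show ?thesis
    unfolding superstructure_def by blast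
qed

text \<open>
  Transfer of the atomic formula \<open>y \<in> A\<close>: the individual \<open>y\<close> is fixed by the star map, so the
  transferred formula speaks of \<open>y\<close> itself.
\<close>

lemma mem_star_set_iff:
  assumes y: "y \<in> base_set X r" and A: "A \<subseteq> base_set X r"
  shows "y \<in> star_set U star A \<longleftrightarrow> y \<in> A"
proof -
  define \<rho> where "\<rho> n = (if n = 0 then y else code U A)" for n :: nat
  have "range \<rho> \<subseteq> superstructure U (base_set X r)"
    using y code_in_superstructure[OF A] base_set_subset_superstructure
    by (auto simp: \<rho>_def)
  from transfer[OF this, of "BMem 0 1"]
  have "mem U y (code U A) \<longleftrightarrow> mem U y (star (code U A))"
    by (simp add: \<rho>_def extension[OF y])
  then show ?thesis
    using elems_code[OF A] by (auto simp: star_set_def elems_def)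
qed

lemma halo_Int_topspace_subset_if_t1:
  assumes "t1_space X" and x: "x \<in> topspace X"
  shows "halo U star X x \<inter> topspace X \<subseteq> {x}"
proof
  fix y
  assume y: "y \<in> halo U star X x \<inter> topspace X"
  show "y \<in> {x}"
  proof (rule ccontr)
    assume "y \<notin> {x}"
    then obtain V where V: "openin X V" "x \<in> V" "y \<notin> V"
      using assms y unfolding t1_space_def by (metis IntD2 singletonI)
    have "y \<in> star_set U star V"
      using y V unfolding halo_def by blast
    moreover have "V \<subseteq> base_set X r" "y \<in> base_set X r"
      using openin_subset[OF V(1)] y by (auto simp: base_set_def)
    ultimately show False
      using mem_star_set_iff V(3) by blast
  qed
qed

end

theorem lemma6p6:
  fixes U :: "'u universe"
    and X :: "'u topology"
    and r :: "real \<Rightarrow> 'u"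
    and star :: "'u \<Rightarrow> 'u"
    and \<kappa> :: "'k rel"
    and \<nu> :: "'p \<Rightarrow> 'u set"
    and \<phi> :: "'p mformula"
  assumes "polysaturated_model U X r star \<kappa>"
    and "t1_space X"
    and "topological_model X \<nu>"
  shows "truth_set U star X \<nu> (Dia_ns \<phi>) = truth_set U star X \<nu> (Dia_d \<phi>)"
proof -
  have "halo U star X x \<inter> (A - topspace X) = halo U star X x \<inter> (A - {x})"
    if "x \<in> topspace X" for x A
    using polysaturated_model.halo_Int_topspace_subset_if_t1[OF assms(1,2) that] that by blast
  then show ?thesis
    by (auto simp only: truth_set.simps)
qed

end
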